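(* Let $n,m\ge 1$ be integers, let $x^1,\ldots,x^m\in\mathbb{R}^n$ be given points and let $\omega_1,\ldots,\omega_m>0$ be given weights. Then the three relaxations $({\rm CR_{ball}})$, $({\rm SDP_{ball}})$, $({\rm SOCP_{ball}})$ of the ball-constrained weighted maximin dispersion problem $\max_{\|x\|\le 1}\min_{i=1,\ldots,m}\omega_i\|x-x^i\|^2$ (defined in the context) satisfy $$v({\rm CR_{ball}})=v({\rm SDP_{ball}})=v({\rm SOCP_{ball}}).$$
   Context: $\|\cdot\|$ is the Euclidean norm, $S^{n+1}$ is the set of real symmetric $(n+1)\times(n+1)$ matrices, $Z\succeq 0$ means that $Z$ is positive semidefinite, ${\rm Tr}$ is the trace, and for $i=1,\ldots,m$ $$A^i=\begin{pmatrix} I & -x^i\\ -(x^i)^T & \|x^i\|^2\end{pmatrix}\in S^{n+1},$$ with $I$ the $n\times n$ identity matrix. $v({\rm CR_{ball}})$ is the optimal value of the second-order cone program $$\max_{x\in\mathbb{R}^n,\ \zeta\in\mathbb{R}}\ \zeta\quad\text{s.t.}\quad \omega_i\left(1-2(x^i)^Tx+\|x^i\|^2\right)\ge\zeta,\ i=1,\ldots,m,\quad \|x\|\le 1.$$ $v({\rm SDP_{ball}})$ is defined by $$\frac{1}{v({\rm SDP_{ball}})}=\min_{Z\in S^{n+1}} Z_{n+1,n+1}\quad\text{s.t.}\quad \omega_i{\rm Tr}(A^iZ)\ge 1\ (i=1,\ldots,m),\quad \sum_{j=1}^n Z_{jj}\le Z_{n+1,n+1},\quad Z\succeq 0.$$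 $v({\rm SOCP_{ball}})$ is defined by $$\frac{1}{v({\rm SOCP_{ball}})}=\min_{Z\in S^{n+1}} Z_{n+1,n+1}\quad\text{s.t.}\quad \omega_i{\rm Tr}(A^iZ)\ge 1\ (i=1,\ldots,m),\quad \sum_{j=1}^n Z_{jj}\le Z_{n+1,n+1},$$ $$\left\|\begin{pmatrix}2Z_{j,n+1}\\ Z_{jj}-Z_{n+1,n+1}\end{pmatrix}\right\|\le Z_{jj}+Z_{n+1,n+1}\ (j=1,\ldots,n).$$ *)

theory Defs
  imports "HOL-Analysis.Analysis"
begin

text \<open>
  Matrices in \<open>S\<^sup>n\<^sup>+\<^sup>1\<close> are indexed by \<open>'n option\<close>: \<open>Some j\<close> stands for the
  \<open>j\<close>-th of the first \<open>n\<close> indices and \<open>None\<close> for the last index \<open>n + 1\<close>.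
\<close>

definition symmetric_mat :: "real^'k^'k \<Rightarrow> bool" where
  "symmetric_mat Z \<longleftrightarrow> transpose Z = Z"

definition psd :: "real^'k^'k \<Rightarrow> bool" where
  "psd Z \<longleftrightarrow> symmetric_mat Z \<and> (\<forall>u. 0 \<le> u \<bullet> (Z *v u))"

definition Amat :: "real^'n \<Rightarrow> real^('n option)^('n option)" where
  "Amat p = (\<chi> r c.
     (case r of
        Some j \<Rightarrow> (case c of Some k \<Rightarrow> (mat 1 :: real^'n^'n) $ j $ k | None \<Rightarrow> - (p $ j))
      | None \<Rightarrow> (case c of Some k \<Rightarrow> - (p $ k) | None \<Rightarrow> (norm p)\<^sup>2)))"

definition CR_feasible ::
  "nat \<Rightarrow> (nat \<Rightarrow> real^'n) \<Rightarrow> (nat \<Rightarrow> real) \<Rightarrow> real^'n \<Rightarrow> real \<Rightarrow> bool" where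
  "CR_feasible m p \<omega> x \<zeta> \<longleftrightarrow>
     (\<forall>i\<in>{1..m}. \<omega> i * (1 - 2 * (p i \<bullet> x) + (norm (p i))\<^sup>2) \<ge> \<zeta>) \<and> norm x \<le> 1"

definition SDP_feasible ::
  "nat \<Rightarrow> (nat \<Rightarrow> real^'n) \<Rightarrow> (nat \<Rightarrow> real) \<Rightarrow> real^('n option)^('n option) \<Rightarrow> bool" where
  "SDP_feasible m p \<omega> Z \<longleftrightarrow>
     symmetric_mat Z \<and>
     (\<forall>i\<in>{1..m}. \<omega> i * trace (Amat (p i) ** Z) \<ge> 1) \<and>
     (\<Sum>j\<in>UNIV. Z $ Some j $ Some j) \<le> Z $ None $ None \<and>
     psd Z"

definition SOCP_feasible ::
  "nat \<Rightarrow> (nat \<Rightarrow> real^'n) \<Rightarrow> (nat \<Rightarrow> real) \<Rightarrow> real^('n option)^('n option) \<Rightarrow> bool" where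
  "SOCP_feasible m p \<omega> Z \<longleftrightarrow>
     symmetric_mat Z \<and>
     (\<forall>i\<in>{1..m}. \<omega> i * trace (Amat (p i) ** Z) \<ge> 1) \<and>
     (\<Sum>j\<in>UNIV. Z $ Some j $ Some j) \<le> Z $ None $ None \<and>
     (\<forall>j. norm (vector [2 * Z $ Some j $ None, Z $ Some j $ Some j - Z $ None $ None] :: real^2)
            \<le> Z $ Some j $ Some j + Z $ None $ None)"

text \<open>
  Optimal values are taken in the extended reals, so that they are meaningful without knowing
  in advance that the programs are feasible and bounded. For the last two programs the minimum
  is \<open>1 / v\<close>; on \<open>ereal\<close>, \<open>1 / 0 = \<infinity>\<close> and \<open>1 / \<infinity> = 0\<close>.
\<close>

definition v_CR :: "nat \<Rightarrow> (nat \<Rightarrow> real^'n) \<Rightarrow> (nat \<Rightarrow> real) \<Rightarrow> ereal" where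
  "v_CR m p \<omega> = Sup {ereal \<zeta> | x \<zeta>. CR_feasible m p \<omega> x \<zeta>}"

definition v_SDP :: "nat \<Rightarrow> (nat \<Rightarrow> real^'n) \<Rightarrow> (nat \<Rightarrow> real) \<Rightarrow> ereal" where
  "v_SDP m p \<omega> = 1 / Inf {ereal (Z $ None $ None) | Z. SDP_feasible m p \<omega> Z}"

definition v_SOCP :: "nat \<Rightarrow> (nat \<Rightarrow> real^'n) \<Rightarrow> (nat \<Rightarrow> real) \<Rightarrow> ereal" where
  "v_SOCP m p \<omega> = 1 / Inf {ereal (Z $ None $ None) | Z. SOCP_feasible m p \<omega> Z}"

end

theory Submission
  imports Defs
begin

text \<open>
  The semidefinite and the second-order cone constraints both imply
  \<open>Z\<^sub>j\<^sub>,\<^sub>n\<^sub>+\<^sub>1\<^sup>2 \<le> Z\<^sub>j\<^sub>j Z\<^sub>n\<^sub>+\<^sub>1\<^sub>,\<^sub>n\<^sub>+\<^sub>1\<close>. With \<open>t = Z\<^sub>n\<^sub>+\<^sub>1\<^sub>,\<^sub>n\<^sub>+\<^sub>1\<close>, if \<open>t = 0\<close>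
  then every trace \<open>Tr (A\<^sup>i Z)\<close> would vanish; so \<open>t > 0\<close>, and dividing the last column of \<open>Z\<close>
  by \<open>t\<close> gives a point of the unit ball with value at least \<open>1 / t\<close> in the convex
  relaxation. Conversely, a point \<open>x\<close> of the ball with value \<open>\<zeta> > 0\<close> lifts to
  \<open>(1 / \<zeta>) ((x, 1) (x, 1)\<^sup>T + (1 - \<parallel>x\<parallel>\<^sup>2) e e\<^sup>T)\<close>, where \<open>e\<close> is one of the first \<open>n\<close> unit vectors;
  the correction term makes the first \<open>n\<close> diagonal entries sum to the last one.
\<close>

lemma sum_UNIV_option:
  fixes f :: "'a::finite option \<Rightarrow> 'b::comm_monoid_add"
  shows "sum f UNIV = f None + (\<Sum>j\<in>UNIV. f (Some j))"
  by (simp add: UNIV_option_conv sum.reindex o_def)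

lemma symmetric_mat_nth: "symmetric_mat Z \<Longrightarrow> Z $ i $ j = Z $ j $ i"
  by (auto simp: symmetric_mat_def transpose_def vec_eq_iff)

text \<open>The trace constraint sees \<open>Z\<close> only through three quantities: the sum of the
  first n diagonal entries, the last column and the corner. Symmetry merges the last row with the
  last column and gives the factor 2.\<close>

lemma trace_Amat_mult:
  fixes p :: "real^'n"
  assumes "symmetric_mat Z"
  shows "trace (Amat p ** Z) = (\<Sum>j\<in>UNIV. Z $ Some j $ Some j)
    - 2 * (p \<bullet> (\<chi> j. Z $ Some j $ None)) + (norm p)\<^sup>2 * Z $ None $ None"
proof -
  have sym: "Z $ None $ Some j = Z $ Some j $ None" for j
    using assms by (rule symmetric_mat_nth)
  show ?thesis
    unfolding trace_def matrix_matrix_mult_def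
    by (simp add: sum_UNIV_option Amat_def mat_def inner_vec_def sym sum.distrib sum_negf
        if_distrib [of "\<lambda>z. z * _"] cong: if_cong)
qed

lemma norm_vector_2: "norm (vector [a, b] :: real^2) = sqrt (a\<^sup>2 + b\<^sup>2)"
  by (simp add: norm_vec_def L2_set_def sum_2)

text \<open>After squaring, the difference of \<open>(a + t)\<^sup>2\<close> and
  \<open>(a - t)\<^sup>2\<close> is \<open>4 * a * t\<close>. The cone is thus positive
  semidefiniteness of the 2x2 matrix with diagonal a, t and off-diagonal entry y.\<close>

lemma socp_cone_iff:
  fixes y a t :: real
  shows "norm (vector [2 * y, a - t] :: real^2) \<le> a + t \<longleftrightarrow> y\<^sup>2 \<le> a * t \<and> 0 \<le> a \<and> 0 \<le> t"
proof -
  have "norm (vector [2 * y, a - t] :: real^2) \<le> a + t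
      \<longleftrightarrow> 0 \<le> a + t \<and> (2 * y)\<^sup>2 + (a - t)\<^sup>2 \<le> (a + t)\<^sup>2"
    unfolding norm_vector_2
    by (meson add_nonneg_nonneg order_trans real_le_lsqrt real_sqrt_ge_zero sqrt_le_D zero_le_power2)
  also have "(2 * y)\<^sup>2 + (a - t)\<^sup>2 \<le> (a + t)\<^sup>2 \<longleftrightarrow> y\<^sup>2 \<le> a * t"
    by (simp add: power2_eq_square algebra_simps)
  also have "0 \<le> a + t \<and> y\<^sup>2 \<le> a * t \<longleftrightarrow> y\<^sup>2 \<le> a * t \<and> 0 \<le> a \<and> 0 \<le> t"
  proof -
    \<comment> \<open>A nonnegative product could come from two negative factors, but their sum
      would be negative.\<close>
    have "0 \<le> a \<and> 0 \<le> t" if "0 \<le> a + t" "y\<^sup>2 \<le> a * t"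
    proof -
      have "0 \<le> a * t"
        using that(2) zero_le_power2 [of y] by linarith
      then show ?thesis
        using that(1) by (auto simp: zero_le_mult_iff)
    qed
    then show ?thesis by auto
  qed
  finally show ?thesis .
qed

lemma psd_quadratic_form:
  fixes Z :: "real^'k^'k"
  assumes "psd Z" and "i \<noteq> j"
  shows "0 \<le> a\<^sup>2 * Z $ i $ i + 2 * a * b * Z $ i $ j + b\<^sup>2 * Z $ j $ j"
proof -
  have sym: "Z $ j $ i = Z $ i $ j"
    using assms(1) by (simp add: psd_def symmetric_mat_nth)
  define u :: "real^'k" where "u = axis i a + axis j b"
  have "Z *v u = (\<chi> r. a * Z $ r $ i + b * Z $ r $ j)"
    unfolding u_def matrix_vector_right_distrib
    by (simp add: vec_eq_iff matrix_vector_mult_def axis_def if_distrib [of "\<lambda>z. _ * z"]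
        cong: if_cong)
  then have "u \<bullet> (Z *v u) = a\<^sup>2 * Z $ i $ i + 2 * a * b * Z $ i $ j + b\<^sup>2 * Z $ j $ j"
    by (simp add: u_def inner_add_left inner_axis' sym power2_eq_square algebra_simps)
  then show ?thesis
    using assms(1) by (metis psd_def)
qed

lemma psd_minor:
  fixes Z :: "real^'k^'k"
  assumes "psd Z" and "i \<noteq> j"
  shows "(Z $ i $ j)\<^sup>2 \<le> Z $ i $ i * Z $ j $ j" "0 \<le> Z $ i $ i" "0 \<le> Z $ j $ j"
proof -
  let ?a = "Z $ i $ i" and ?y = "Z $ i $ j" and ?t = "Z $ j $ j"
  note q = psd_quadratic_form [OF assms]
  show a: "0 \<le> ?a" and "0 \<le> ?t"
    using q [of 1 0] q [of 0 1] by simp_all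
  show "?y\<^sup>2 \<le> ?a * ?t"
  proof (cases "?a = 0")
    case True
    have "?y = 0"
    proof (rule ccontr)
      assume "?y \<noteq> 0"
      \<comment> \<open>With \<open>?a = 0\<close> and second coefficient 1 the form is affine in
        the first coefficient; this choice gives it the value -1.\<close>
      then show False
        using q [of "- (?t + 1) / (2 * ?y)" 1] True by (simp add: field_simps)
    qed
    then show ?thesis
      using True by simp
  next
    case False
    \<comment> \<open>The coefficients \<open>- ?y\<close> and \<open>?a\<close> make the form equal
      to \<open>?a\<close> times the minor.\<close>
    have "0 \<le> ?a * (?a * ?t - ?y\<^sup>2)"
      using q [of "- ?y" ?a] by (simp add: power2_eq_square algebra_simps)
    then show ?thesis
      using a False by (simp add: zero_le_mult_iff)
  qed
qed

text \<open>For each j the cone constraint is positive semidefiniteness of the principal submatrix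
  of \<open>Z\<close> on the indices \<open>Some j\<close> and \<open>None\<close>.\<close>

lemma SDP_feasible_imp_SOCP_feasible: "SDP_feasible m p \<omega> Z \<Longrightarrow> SOCP_feasible m p \<omega> Z"
  unfolding SDP_feasible_def SOCP_feasible_def socp_cone_iff
  using psd_minor [of Z] by blast

text \<open>Positivity of the corner is a conclusion of its own because division by zero yields
  zero: without it a bound on the reciprocal could not be inverted.\<close>

lemma SOCP_feasible_imp_CR_feasible:
  fixes p :: "nat \<Rightarrow> real^'n"
  assumes "1 \<le> m" and pos: "\<And>i. i \<in> {1..m} \<Longrightarrow> 0 < \<omega> i" and feas: "SOCP_feasible m p \<omega> Z"
  shows "0 < Z $ None $ None"
    and "CR_feasible m p \<omega> ((1 / Z $ None $ None) *\<^sub>R (\<chi> j. Z $ Some j $ None)) (1 / Z $ None $ None)"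
proof -
  define t where "t = Z $ None $ None"
  define y :: "real^'n" where "y = (\<chi> j. Z $ Some j $ None)"
  define S where "S = (\<Sum>j\<in>UNIV. Z $ Some j $ Some j)"
  have sym: "symmetric_mat Z" and St: "S \<le> t"
    and cone: "\<And>j. (y $ j)\<^sup>2 \<le> Z $ Some j $ Some j * t \<and> 0 \<le> Z $ Some j $ Some j \<and> 0 \<le> t"
    using feas unfolding SOCP_feasible_def socp_cone_iff S_def t_def y_def by simp_all
  have ge1: "1 \<le> \<omega> i * (S - 2 * (p i \<bullet> y) + (norm (p i))\<^sup>2 * t)" if "i \<in> {1..m}" for i
    using feas that unfolding SOCP_feasible_def trace_Amat_mult [OF sym] S_def t_def y_def by blast
  \<comment> \<open>Adding the cone inequalities over j bounds the whole column;
    \<open>S \<le> t\<close> then puts \<open>y\<close> in the ball of radius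
    \<open>t\<close>.\<close>
  have "(norm y)\<^sup>2 = (\<Sum>j\<in>UNIV. (y $ j)\<^sup>2)"
    by (simp add: power2_norm_eq_inner inner_vec_def flip: power2_eq_square)
  also have "\<dots> \<le> S * t"
    unfolding S_def sum_distrib_right using cone by (intro sum_mono) blast
  finally have ySt: "(norm y)\<^sup>2 \<le> S * t" .
  have t0: "0 \<le> t" and S0: "0 \<le> S"
    using cone by (auto simp: S_def intro: sum_nonneg)
  have t: "0 < t"
  proof (rule ccontr)
    assume "\<not> 0 < t"
    then have "t = 0" "S = 0" "y = 0"
      using t0 S0 St ySt by auto
    \<comment> \<open>With all three quantities zero, the trace constraint for index 1 reads 1 \<le>
      0.\<close>
    then show False
      using ge1 [of 1] \<open>1 \<le> m\<close> by simp
  qed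
  have "(norm y)\<^sup>2 \<le> t\<^sup>2"
    using ySt mult_right_mono [OF St t0] by (simp add: power2_eq_square)
  then have "norm y \<le> t"
    using t0 power2_le_imp_le by blast
  then have ball: "norm ((1 / t) *\<^sub>R y) \<le> 1"
    using t by simp
  have "1 / t \<le> \<omega> i * (1 - 2 * (p i \<bullet> ((1 / t) *\<^sub>R y)) + (norm (p i))\<^sup>2)" if i: "i \<in> {1..m}" for i
  proof -
    \<comment> \<open>Since the weight is positive, replacing \<open>S\<close> by the larger
      \<open>t\<close> keeps the inequality; division by \<open>t\<close> then turns it into the
      constraint of the convex relaxation.\<close>
    have "1 \<le> \<omega> i * (t - 2 * (p i \<bullet> y) + (norm (p i))\<^sup>2 * t)"
      using ge1 [OF i] mult_left_mono [OF St less_imp_le [OF pos [OF i]]]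
      by (simp add: algebra_simps)
    then have "1 / t \<le> \<omega> i * (t - 2 * (p i \<bullet> y) + (norm (p i))\<^sup>2 * t) / t"
      using t by (intro divide_right_mono) auto
    also have "\<dots> = \<omega> i * (1 - 2 * (p i \<bullet> ((1 / t) *\<^sub>R y)) + (norm (p i))\<^sup>2)"
      using t by (simp add: field_simps)
    finally show ?thesis .
  qed
  with ball t show "0 < Z $ None $ None"
    and "CR_feasible m p \<omega> ((1 / Z $ None $ None) *\<^sub>R (\<chi> j. Z $ Some j $ None)) (1 / Z $ None $ None)"
    unfolding CR_feasible_def t_def y_def by blast+
qed

lemma CR_feasible_imp_SDP_feasible:
  fixes p :: "nat \<Rightarrow> real^'n"
  assumes feas: "CR_feasible m p \<omega> x \<zeta>" and "0 < \<zeta>"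
  obtains Z where "SDP_feasible m p \<omega> Z" "Z $ None $ None = 1 / \<zeta>"
proof
  define v :: "real^('n option)" where "v = (\<chi> r. case r of Some j \<Rightarrow> x $ j | None \<Rightarrow> 1)"
  \<comment> \<open>Any of the first n coordinates would serve, so \<open>undefined\<close> is
    taken. As \<open>e\<close> vanishes at \<open>None\<close>, it changes neither the last column
    nor the corner of \<open>Z\<close>.\<close>
  define e :: "real^('n option)" where "e = axis (Some undefined) (sqrt (1 - (norm x)\<^sup>2))"
  define Z where "Z = (\<chi> r c. (v $ r * v $ c + e $ r * e $ c) / \<zeta>)"
  have v_simps [simp]: "v $ None = 1" "v $ Some j = x $ j" "e $ None = 0" for j
    by (simp_all add: v_def e_def axis_def)
  show last: "Z $ None $ None = 1 / \<zeta>"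
    by (simp add: Z_def)
  have sym: "symmetric_mat Z"
    by (simp add: symmetric_mat_def transpose_def Z_def vec_eq_iff mult.commute)
  have "(norm x)\<^sup>2 \<le> 1"
    using feas by (simp add: CR_feasible_def power_le_one)
  then have "(\<Sum>j\<in>UNIV. e $ Some j * e $ Some j) = 1 - (norm x)\<^sup>2"
    by (simp add: e_def axis_def if_distrib [of "\<lambda>z. z * _"] cong: if_cong)
  moreover have "(\<Sum>j\<in>UNIV. x $ j * x $ j) = (norm x)\<^sup>2"
    by (simp add: power2_norm_eq_inner inner_vec_def)
  ultimately have diag: "(\<Sum>j\<in>UNIV. Z $ Some j $ Some j) = 1 / \<zeta>"
    by (simp add: Z_def sum.distrib flip: sum_divide_distrib)
  have col: "(\<chi> j. Z $ Some j $ None) = (1 / \<zeta>) *\<^sub>R x"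
    by (simp add: Z_def vec_eq_iff)
  have "1 \<le> \<omega> i * trace (Amat (p i) ** Z)" if "i \<in> {1..m}" for i
  proof -
    have "trace (Amat (p i) ** Z) = (1 - 2 * (p i \<bullet> x) + (norm (p i))\<^sup>2) / \<zeta>"
      unfolding trace_Amat_mult [OF sym] diag last col
      by (simp add: add_divide_distrib diff_divide_distrib)
    then show ?thesis
      using feas that \<open>0 < \<zeta>\<close> by (simp add: CR_feasible_def)
  qed
  moreover have "psd Z"
    unfolding psd_def
  proof (intro conjI allI sym)
    fix u
    \<comment> \<open>\<open>Z\<close> is a positive multiple of a sum of two rank-one squares, so
      its quadratic form is a sum of squares.\<close>
    have "Z *v u = (1 / \<zeta>) *\<^sub>R ((v \<bullet> u) *\<^sub>R v + (e \<bullet> u) *\<^sub>R e)"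
      by (simp add: vec_eq_iff Z_def matrix_vector_mult_def inner_vec_def sum_distrib_left
          sum_distrib_right sum_divide_distrib add_divide_distrib sum.distrib algebra_simps)
    then have "u \<bullet> (Z *v u) = ((v \<bullet> u)\<^sup>2 + (e \<bullet> u)\<^sup>2) / \<zeta>"
      by (simp add: inner_add_right inner_commute power2_eq_square)
    then show "0 \<le> u \<bullet> (Z *v u)"
      using \<open>0 < \<zeta>\<close> by simp
  qed
  ultimately show "SDP_feasible m p \<omega> Z"
    unfolding SDP_feasible_def using sym diag last by simp
qed

text \<open>A minimum of finitely many affine functions is continuous and attains its maximum on the
  compact ball. Positivity of the optimum is what allows the optimal point to be lifted to a
  matrix.\<close>

lemma CR_optimum_attained:
  fixes p :: "nat \<Rightarrow> real^'n"
  assumes "1 \<le> m" and pos: "\<And>i. i \<in> {1..m} \<Longrightarrow> 0 < \<omega> i"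
  obtains x \<zeta> where "CR_feasible m p \<omega> x \<zeta>" "0 < \<zeta>"
    "\<And>x' \<zeta>'. CR_feasible m p \<omega> x' \<zeta>' \<Longrightarrow> \<zeta>' \<le> \<zeta>"
proof -
  define g where "g i x = \<omega> i * (1 - 2 * (p i \<bullet> x) + (norm (p i))\<^sup>2)" for i x
  define f where "f x = (INF i\<in>{1..m}. g i x)" for x
  have ne: "{1..m} \<noteq> {}"
    using \<open>1 \<le> m\<close> by simp
  \<comment> \<open>This eliminates the scalar variable: for fixed \<open>x\<close> in the ball its
    best value is \<open>f x\<close>.\<close>
  have feas_iff: "CR_feasible m p \<omega> x \<zeta> \<longleftrightarrow> \<zeta> \<le> f x \<and> norm x \<le> 1" for x \<zeta>
    using ne by (simp add: CR_feasible_def f_def g_def le_cINF_iff)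
  have f_Min: "f x = Min ((\<lambda>i. g i x) ` {1..m})" for x
    using ne by (simp add: f_def cInf_eq_Min)
  have "continuous_on (cball 0 1) f"
  proof -
    have "continuous_on A (\<lambda>x. Min ((\<lambda>i. g i x) ` I))" if "finite I" "I \<noteq> {}" for A I
      using that
    proof (induction rule: finite_ne_induct)
      case (singleton i)
      then show ?case
        by (auto simp: g_def intro!: continuous_intros)
    next
      case (insert i I)
      have "continuous_on A (g i)"
        unfolding g_def by (intro continuous_intros)
      with insert show ?case
        by (auto intro: continuous_on_min)
    qed
    then show ?thesis
      unfolding f_Min using ne by blast
  qed
  then obtain x where x: "x \<in> cball 0 1" and max: "\<And>y. y \<in> cball 0 1 \<Longrightarrow> f y \<le> f x"
    using continuous_attains_sup [of "cball 0 1 :: (real^'n) set" f] by auto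
  \<comment> \<open>At the origin the i-th function equals
    \<open>\<omega> i * (1 + (norm (p i))\<^sup>2)\<close>.\<close>
  have "0 < f 0"
    unfolding f_Min using ne pos
    by (auto simp: g_def intro!: mult_pos_pos add_pos_nonneg)
  also have "f 0 \<le> f x"
    by (simp add: max)
  finally have "0 < f x" .
  show thesis
  proof
    show "CR_feasible m p \<omega> x (f x)"
      using x by (simp add: feas_iff)
    show "\<zeta>' \<le> f x" if "CR_feasible m p \<omega> x' \<zeta>'" for x' \<zeta>'
      using that max [of x'] by (simp add: feas_iff)
  qed fact
qed

text \<open>The values are defined by a supremum and two infima; the existential conjuncts record
  that they are attained, as the words max and min in the three programs assert.\<close>

theorem theorem2p2:
  fixes m :: nat and p :: "nat \<Rightarrow> real^'n" and \<omega> :: "nat \<Rightarrow> real"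
  assumes "m \<ge> 1" and "\<And>i. i \<in> {1..m} \<Longrightarrow> \<omega> i > 0"
  shows "v_CR m p \<omega> = v_SDP m p \<omega> \<and> v_SDP m p \<omega> = v_SOCP m p \<omega>
    \<and> (\<exists>x \<zeta>. CR_feasible m p \<omega> x \<zeta> \<and> v_CR m p \<omega> = ereal \<zeta>)
    \<and> (\<exists>Z. SDP_feasible m p \<omega> Z \<and> 1 / v_SDP m p \<omega> = ereal (Z $ None $ None))
    \<and> (\<exists>Z. SOCP_feasible m p \<omega> Z \<and> 1 / v_SOCP m p \<omega> = ereal (Z $ None $ None))"
proof -
  obtain x \<zeta> where feas: "CR_feasible m p \<omega> x \<zeta>" and "0 < \<zeta>"
    and max: "\<And>x' \<zeta>'. CR_feasible m p \<omega> x' \<zeta>' \<Longrightarrow> \<zeta>' \<le> \<zeta>"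
    using CR_optimum_attained [of m \<omega> p, OF assms] by blast
  obtain Z where sdp: "SDP_feasible m p \<omega> Z" and Z: "Z $ None $ None = 1 / \<zeta>"
    using CR_feasible_imp_SDP_feasible [OF feas \<open>0 < \<zeta>\<close>] .
  have socp: "SOCP_feasible m p \<omega> Z"
    using sdp by (rule SDP_feasible_imp_SOCP_feasible)
  \<comment> \<open>One lower bound serves both matrix programs, since every SDP-feasible matrix is
    SOCP-feasible; the lifted \<open>Z\<close> attains it in both.\<close>
  have lower: "1 / \<zeta> \<le> W $ None $ None" if "SOCP_feasible m p \<omega> W" for W
  proof -
    note W = SOCP_feasible_imp_CR_feasible [of m \<omega> p, OF assms that]
    have "1 / W $ None $ None \<le> \<zeta>"
      using W(2) by (rule max)
    then show ?thesis
      using W(1) \<open>0 < \<zeta>\<close> by (simp add: field_simps)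
  qed
  have "v_CR m p \<omega> = ereal \<zeta>"
    unfolding v_CR_def using feas max by (intro antisym Sup_least Sup_upper) auto
  moreover have "Inf {ereal (Z $ None $ None) | Z. SDP_feasible m p \<omega> Z} = ereal (1 / \<zeta>)"
    using sdp lower [OF SDP_feasible_imp_SOCP_feasible]
    by (intro antisym Inf_greatest Inf_lower) (auto simp flip: Z)
  then have "v_SDP m p \<omega> = ereal \<zeta>"
    using \<open>0 < \<zeta>\<close> by (simp add: v_SDP_def one_ereal_def)
  moreover have "Inf {ereal (Z $ None $ None) | Z. SOCP_feasible m p \<omega> Z} = ereal (1 / \<zeta>)"
    using socp lower by (intro antisym Inf_greatest Inf_lower) (auto simp flip: Z)
  then have "v_SOCP m p \<omega> = ereal \<zeta>"
    using \<open>0 < \<zeta>\<close> by (simp add: v_SOCP_def one_ereal_def)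
  moreover have "1 / ereal \<zeta> = ereal (Z $ None $ None)"
    using \<open>0 < \<zeta>\<close> Z by (simp add: one_ereal_def)
  ultimately show ?thesis
    using feas sdp socp by auto
qed

end
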